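(* Let $g,h:\mathbb{R}^m\to\mathbb{R}\cup\{+\infty\}$ and $\phi=g-h$ satisfy the standing assumptions described in the context. For any $x_0\in\mathbb{R}^m$, either BDCA (described in the context) started at $x_0$ returns a critical point of $(\mathcal P)$, or it generates an infinite sequence such that the following holds. (i) $\phi(x_k)$ is monotonically decreasing and convergent to some $\phi^*$. (ii) Any limit point of $\{x_k\}$ is a critical point of $(\mathcal P)$. If, in addition, $\phi$ is coercive, then there exists a subsequence of $\{x_k\}$ which converges to a critical point of $(\mathcal P)$. (iii) $\sum_{k=0}^{+\infty}\|d_k\|^2<+\infty$. Further, if there is some $\overline\lambda$ such that $\lambda_k\le\overline\lambda$ for all $k$, then $\sum_{k=0}^{+\infty}\|x_{k+1}-x_k\|^2<+\infty$.
   Context: Problem. $\|\cdot\|$ and $\langle\cdot,\cdot\rangle$ are the Euclidean norm and inner product of $\mathbb{R}^m$. We consider $(\mathcal P)$: minimize $\phi(x):=g(x)-h(x)$ over $x\in\mathbb{R}^m$, where $g,h:\mathbb{R}^m\to\mathbb{R}\cup\{+\infty\}$ are proper convex functions, with the conventions $(+\infty)-(+\infty)=+\infty$, $(+\infty)-\lambda=+\infty$ and $\lambda-(+\infty)=-\infty$ for $\lambda\in\,]-\infty,+\infty[$. We write $\operatorname{dom} f=\{x: f(x)<+\infty\}$. The convex subdifferential is $\partial h(\bar x)=\{u\in\mathbb{R}^m: h(x)-h(\bar x)\ge\langle u,x-\bar x\rangle\ \forall x\in\mathbb{R}^m\}$ for $\bar x\in\operatorname{dom}h$, and $\partial h(\bar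 x)=\emptyset$ otherwise. A point $\bar x$ is a critical point of $(\mathcal P)$ if $\nabla g(\bar x)\in\partial h(\bar x)$. The function $\phi$ is coercive if $\phi(x)\to+\infty$ whenever $\|x\|\to+\infty$. Standing assumptions. (Assumption 1) Both $g$ and $h$ are strongly convex with modulus $\rho>0$, i.e. $g-\frac{\rho}{2}\|\cdot\|^2$ and $h-\frac{\rho}{2}\|\cdot\|^2$ are convex. (Assumption 2) $\partial h(x)\ne\emptyset$ for all $x\in\operatorname{dom}h$; $g$ is continuously differentiable on an open set containing $\operatorname{dom}h$; and $\inf_{x\in\mathbb{R}^m}\phi(x)>-\infty$. BDCA (Boosted DC Algorithm). Step 1. Fix $\alpha>0$ and $0<\beta<1$. Let $x_0$ be any initial point and set $k:=0$. Step 2. Select $u_k\in\partial h(x_k)$ and solve the strongly convex problem $(\mathcal P_k)$: minimize $g(x)-\langle u_k,x\rangle$ over $x\in\mathbb{R}^m$, to obtain its unique solution $y_k$. Step 3. Set $d_k:=y_k-x_k$. If $d_k=0$, stop and return $x_k$. Otherwise go to Step 4. Step 4. Choose any $\overline\lambda_k\ge0$ and set $\lambda_k:=\overline\lambda_k$. While $\phi(y_k+\lambda_kd_k)>\phi(y_k)-\alpha\lambda_k^2\|d_k\|^2$, replace $\lambda_k:=\beta\lambda_k$. Step 5. Set $x_{k+1}:=y_k+\lambda_kd_k$, set $k:=k+1$, and go to Step 2. It is understood that Step 2 can be carried out at each iteration, i.e. $\partial h(x_k)\neq\emptyset$ (in particular for the starting point $x_0$) and $(\mathcal P_k)$ has a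 (unique) solution $y_k$. In the statement, $\lambda_k$ denotes the final value accepted in Step 4.
   Formalization: In (ii), limit points are claimed critical only if they lie in dom h, and the coercive claim also assumes all limit points of {x_k} lie in dom h; otherwise (ii) fails, e.g. g=x², h=x²/2 for x>0, both +∞ elsewhere, where x_k=2^{-k}→0. *)

theory Defs
  imports "HOL-Analysis.Analysis" "HOL-Library.While_Combinator"
begin

text \<open>
  Functions into the reals extended by plus infinity are functions into \<^typ>\<open>ereal\<close> that
  never take the value minus infinity (part of \<open>proper_fun\<close>). The space is an arbitrary
  finite-dimensional Euclidean space.
\<close>

definition edom :: "('a \<Rightarrow> ereal) \<Rightarrow> 'a set" where
  "edom f = {x. f x < \<infinity>}"

definition proper_fun :: "('a \<Rightarrow> ereal) \<Rightarrow> bool" where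
  "proper_fun f \<longleftrightarrow> (\<forall>x. f x \<noteq> -\<infinity>) \<and> edom f \<noteq> {}"

text \<open>
  Used only for functions that are nowhere minus infinity, so the right-hand side never
  adds infinities of opposite sign; in \<^typ>\<open>ereal\<close>, zero times infinity is zero.
\<close>

definition convex_fun :: "('a::euclidean_space \<Rightarrow> ereal) \<Rightarrow> bool" where
  "convex_fun f \<longleftrightarrow>
     (\<forall>x y. \<forall>t\<in>{0..1::real}.
        f ((1 - t) *\<^sub>R x + t *\<^sub>R y) \<le> ereal (1 - t) * f x + ereal t * f y)"

definition strongly_convex_fun :: "real \<Rightarrow> ('a::euclidean_space \<Rightarrow> ereal) \<Rightarrow> bool" where
  "strongly_convex_fun \<rho> f \<longleftrightarrow> convex_fun (\<lambda>x. f x - ereal (\<rho> / 2 * (norm x)\<^sup>2))"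

definition subdifferential :: "('a::euclidean_space \<Rightarrow> ereal) \<Rightarrow> 'a \<Rightarrow> 'a set" where
  "subdifferential h z =
     (if z \<in> edom h then {u. \<forall>x. h x - h z \<ge> ereal (u \<bullet> (x - z))} else {})"

text \<open>
  The finiteness requirement prevents \<^const>\<open>real_of_ereal\<close> from mapping an infinite value
  to zero.
\<close>

definition has_gradient :: "('a::euclidean_space \<Rightarrow> ereal) \<Rightarrow> 'a \<Rightarrow> 'a \<Rightarrow> bool" where
  "has_gradient g G z \<longleftrightarrow>
     (\<forall>\<^sub>F x in nhds z. \<bar>g x\<bar> \<noteq> \<infinity>) \<and> GDERIV (\<lambda>x. real_of_ereal (g x)) z :> G"

definition continuously_differentiable_on ::
  "('a::euclidean_space \<Rightarrow> ereal) \<Rightarrow> 'a set \<Rightarrow> bool" where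
  "continuously_differentiable_on g U \<longleftrightarrow>
     (\<exists>G. (\<forall>x\<in>U. has_gradient g (G x) x) \<and> continuous_on U G)"

text \<open>
  Subtraction on \<^typ>\<open>ereal\<close> obeys the conventions for the difference of two such
  functions: infinity minus infinity is infinity, infinity minus a real is infinity, and a
  real minus infinity is minus infinity.
\<close>

definition dc_objective :: "('a \<Rightarrow> ereal) \<Rightarrow> ('a \<Rightarrow> ereal) \<Rightarrow> 'a \<Rightarrow> ereal" where
  "dc_objective g h x = g x - h x"

definition critical_point ::
  "('a::euclidean_space \<Rightarrow> ereal) \<Rightarrow> ('a \<Rightarrow> ereal) \<Rightarrow> 'a \<Rightarrow> bool" where
  "critical_point g h z \<longleftrightarrow> (\<exists>G. has_gradient g G z \<and> G \<in> subdifferential h z)"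

definition coercive :: "('a::euclidean_space \<Rightarrow> ereal) \<Rightarrow> bool" where
  "coercive f \<longleftrightarrow> (f \<longlongrightarrow> \<infinity>) at_infinity"

definition dc_assumptions ::
  "real \<Rightarrow> ('a::euclidean_space \<Rightarrow> ereal) \<Rightarrow> ('a \<Rightarrow> ereal) \<Rightarrow> bool" where
  "dc_assumptions \<rho> g h \<longleftrightarrow>
     proper_fun g \<and> convex_fun g \<and> proper_fun h \<and> convex_fun h \<and>
     \<rho> > 0 \<and> strongly_convex_fun \<rho> g \<and> strongly_convex_fun \<rho> h \<and>
     (\<forall>x\<in>edom h. subdifferential h x \<noteq> {}) \<and>
     (\<exists>U. open U \<and> edom h \<subseteq> U \<and> continuously_differentiable_on g U) \<and>
     (INF x. dc_objective g h x) > -\<infinity>"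

text \<open>
  Backtracking from the trial value \<open>l\<close> at the point \<open>y\<close> along \<open>d\<close>; the result is
  \<^const>\<open>None\<close> if the loop does not terminate.
\<close>

definition line_search ::
  "('a::euclidean_space \<Rightarrow> ereal) \<Rightarrow> real \<Rightarrow> real \<Rightarrow> 'a \<Rightarrow> 'a \<Rightarrow> real \<Rightarrow> real option" where
  "line_search \<phi> \<alpha> \<beta> y d l =
     while_option
       (\<lambda>s. \<phi> (y + s *\<^sub>R d) > \<phi> y - ereal (\<alpha> * s\<^sup>2 * (norm d)\<^sup>2))
       (\<lambda>s. \<beta> * s) l"

text \<open>
  A maximal execution of BDCA started at \<open>x0\<close>, for arbitrary choices of the subgradients
  \<open>u k\<close> and of the trial step sizes \<open>lbar k\<close>. The iterations that are completed are those
  with index below \<open>N\<close>, and \<open>lam k\<close> is the step size accepted in iteration \<open>k\<close>. Every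
  iteration that is entered (index at most \<open>N\<close>) carries out its subgradient selection and
  solves its convex subproblem. If \<open>N\<close> is finite, iteration \<open>N\<close> is entered but not
  completed: it meets the stopping criterion or its line search runs forever. That the
  latter never happens is left to be proved.
\<close>

definition bdca_run ::
  "('a::euclidean_space \<Rightarrow> ereal) \<Rightarrow> ('a \<Rightarrow> ereal) \<Rightarrow> real \<Rightarrow> real \<Rightarrow> 'a \<Rightarrow> enat \<Rightarrow>
   (nat \<Rightarrow> 'a) \<Rightarrow> (nat \<Rightarrow> 'a) \<Rightarrow> (nat \<Rightarrow> 'a) \<Rightarrow> (nat \<Rightarrow> 'a) \<Rightarrow>
   (nat \<Rightarrow> real) \<Rightarrow> (nat \<Rightarrow> real) \<Rightarrow> bool" where
  "bdca_run g h \<alpha> \<beta> x0 N x u y d lbar lam \<longleftrightarrow>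
     x 0 = x0 \<and>
     (\<forall>k. enat k \<le> N \<longrightarrow>
        u k \<in> subdifferential h (x k) \<and>
        is_arg_min (\<lambda>z. g z - ereal (u k \<bullet> z)) (\<lambda>_. True) (y k) \<and>
        d k = y k - x k) \<and>
     (\<forall>k. enat k < N \<longrightarrow>
        d k \<noteq> 0 \<and> lbar k \<ge> 0 \<and>
        line_search (dc_objective g h) \<alpha> \<beta> (y k) (d k) (lbar k) = Some (lam k) \<and>
        x (Suc k) = y k + lam k *\<^sub>R d k) \<and>
     (\<forall>n. N = enat n \<longrightarrow>
        d n = 0 \<or>
        (lbar n \<ge> 0 \<and>
         line_search (dc_objective g h) \<alpha> \<beta> (y n) (d n) (lbar n) = None))"

text \<open>
  The assumptions make the domain of \<open>h\<close> open, and a limit point of the iterates may lie on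
  its boundary, where the subdifferential of \<open>h\<close> is empty and the point cannot be critical:
  with \<open>g x = x\<^sup>2\<close> and \<open>h x = x\<^sup>2 / 2\<close> for \<open>x > 0\<close>, both infinite otherwise, the iterates
  \<open>(1/2) ^ k\<close> converge to zero. Criticality of limit points is therefore claimed only for
  limit points in \<open>edom h\<close>.
\<close>

definition limit_point_of_seq :: "(nat \<Rightarrow> 'a::topological_space) \<Rightarrow> 'a \<Rightarrow> bool" where
  "limit_point_of_seq x z \<longleftrightarrow> (\<exists>r. strict_mono r \<and> (x \<circ> r) \<longlonglongrightarrow> z)"

end

theory Submission
  imports Defs
begin

text \<open>
  Boundedness below of \<open>\<phi>\<close> forces \<open>dom g \<subseteq> dom h\<close>, and differentiability of \<open>g\<close> around
  \<open>dom h\<close> gives the converse, so both domains are one open set. The point \<open>y k\<close> satisfies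
  \<open>u k = \<nabla>g (y k)\<close>, so \<open>u k\<close> is a subgradient of \<open>h\<close> at \<open>x k\<close> and of \<open>g\<close> at \<open>y k\<close>; adding
  the two strong subgradient inequalities yields \<open>\<phi> (y k) \<le> \<phi> (x k) - \<rho> \<parallel>d k\<parallel>\<^sup>2\<close>.
  A subgradient of \<open>h\<close> at \<open>y k\<close> shows that \<open>\<phi>\<close> decreases from \<open>y k\<close> along \<open>d k\<close> at a linear
  rate at least \<open>\<rho> \<parallel>d k\<parallel>\<^sup>2\<close>, which beats the quadratic term of the line search. Telescoping
  gives the summability, and criticality of limit points follows from continuity of \<open>\<nabla>g\<close>
  and lower semicontinuity of \<open>h\<close>.
\<close>

section \<open>Subgradients of extended-valued functions in real terms\<close>

lemma proper_fun_real:
  assumes "proper_fun f" "z \<in> edom f"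
  shows "f z = ereal (real_of_ereal (f z))"
proof (rule ereal_real'[symmetric])
  show "\<bar>f z\<bar> \<noteq> \<infinity>"
    using assms by (auto simp: proper_fun_def edom_def)
qed

lemma subdifferential_edom: "u \<in> subdifferential f z \<Longrightarrow> z \<in> edom f"
  by (auto simp: subdifferential_def split: if_splits)

lemma subdifferential_real_ineq:
  assumes "proper_fun f" "u \<in> subdifferential f z" "w \<in> edom f"
  shows "u \<bullet> (w - z) \<le> real_of_ereal (f w) - real_of_ereal (f z)"
proof -
  have z: "z \<in> edom f"
    using assms(2) by (rule subdifferential_edom)
  then have "ereal (u \<bullet> (w - z)) \<le> f w - f z"
    using assms(2) by (simp add: subdifferential_def)
  then show ?thesis
    using proper_fun_real[OF assms(1) z] proper_fun_real[OF assms(1,3)]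
    by (metis ereal_less_eq(3) ereal_minus(1))
qed

lemma subdifferentialI_real:
  assumes "proper_fun f" "z \<in> edom f"
    and "\<And>w. w \<in> edom f \<Longrightarrow> u \<bullet> (w - z) \<le> real_of_ereal (f w) - real_of_ereal (f z)"
  shows "u \<in> subdifferential f z"
proof -
  have "ereal (u \<bullet> (w - z)) \<le> f w - f z" for w
  proof (cases "w \<in> edom f")
    case True
    then show ?thesis
      using assms(3)[OF True] proper_fun_real[OF assms(1,2)] proper_fun_real[OF assms(1) True]
      by (metis ereal_less_eq(3) ereal_minus(1))
  next
    case False
    then have "f w = \<infinity>"
      by (simp add: edom_def)
    then show ?thesis
      by simp
  qed
  then show ?thesis
    using assms(2) by (simp add: subdifferential_def)
qed

text \<open>On the segment from \<open>z\<close> to \<open>w\<close>, strong convexity bounds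
  \<open>f\<close> from above and the subgradient bounds it from below. Comparing both bounds,
  dividing by the segment parameter \<open>t\<close> and letting it tend to zero leaves the
  quadratic gain.\<close>

lemma strongly_convex_subgradient_ineq:
  fixes f :: "'a::euclidean_space \<Rightarrow> ereal"
  assumes f: "proper_fun f" "strongly_convex_fun \<rho> f"
    and u: "u \<in> subdifferential f z" and w: "w \<in> edom f"
  shows "u \<bullet> (w - z) + \<rho> / 2 * (norm (w - z))\<^sup>2 \<le> real_of_ereal (f w) - real_of_ereal (f z)"
proof -
  define a b where "a = real_of_ereal (f z)" and "b = real_of_ereal (f w)"
  have fz: "f z = ereal a" and fw: "f w = ereal b"
    using proper_fun_real[OF f(1)] w subdifferential_edom[OF u] by (auto simp: a_def b_def)
  have *: "(1 - t) * (\<rho> / 2 * (norm (w - z))\<^sup>2) \<le> b - a - u \<bullet> (w - z)"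
    if t: "0 < t" "t < 1" for t :: real
  proof -
    define p where "p = (1 - t) *\<^sub>R z + t *\<^sub>R w"
    have "f p - ereal (\<rho> / 2 * (norm p)\<^sup>2)
        \<le> ereal (1 - t) * (f z - ereal (\<rho> / 2 * (norm z)\<^sup>2))
          + ereal t * (f w - ereal (\<rho> / 2 * (norm w)\<^sup>2))"
      using f(2) t unfolding strongly_convex_fun_def convex_fun_def p_def by auto
    then have le: "f p - ereal (\<rho> / 2 * (norm p)\<^sup>2)
        \<le> ereal ((1 - t) * (a - \<rho> / 2 * (norm z)\<^sup>2) + t * (b - \<rho> / 2 * (norm w)\<^sup>2))"
      by (simp add: fz fw)
    \<comment> \<open>The bound just obtained is a real number, so the value at \<open>p\<close>
      cannot be infinite.\<close>
    then have p: "p \<in> edom f"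
      by (cases "f p") (auto simp: edom_def)
    define c where "c = real_of_ereal (f p)"
    have fp: "f p = ereal c"
      using proper_fun_real[OF f(1) p] by (simp add: c_def)
    have up: "c - \<rho> / 2 * (norm p)\<^sup>2
        \<le> (1 - t) * (a - \<rho> / 2 * (norm z)\<^sup>2) + t * (b - \<rho> / 2 * (norm w)\<^sup>2)"
      using le by (simp add: fp)
    have "u \<bullet> (p - z) \<le> c - a"
      using subdifferential_real_ineq[OF f(1) u p] by (simp add: a_def c_def)
    moreover have "p - z = t *\<^sub>R (w - z)"
      by (simp add: p_def algebra_simps)
    ultimately have low: "t * (u \<bullet> (w - z)) \<le> c - a"
      by simp
    have norm_id: "(norm p)\<^sup>2
        = (1 - t) * (norm z)\<^sup>2 + t * (norm w)\<^sup>2 - t * (1 - t) * (norm (w - z))\<^sup>2"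
      unfolding p_def power2_norm_eq_inner
      by (simp add: inner_add_left inner_add_right inner_diff_left inner_diff_right
          inner_commute algebra_simps)
    have "t * ((1 - t) * (\<rho> / 2 * (norm (w - z))\<^sup>2)) \<le> t * (b - a - u \<bullet> (w - z))"
      using up low unfolding norm_id by (simp add: field_simps)
    then show ?thesis
      using t by simp
  qed
  have "((\<lambda>t. (1 - t) * (\<rho> / 2 * (norm (w - z))\<^sup>2))
      \<longlongrightarrow> (1 - 0) * (\<rho> / 2 * (norm (w - z))\<^sup>2)) (at_right (0::real))"
    by (intro tendsto_intros)
  moreover have "\<forall>\<^sub>F t in at_right (0::real).
      (1 - t) * (\<rho> / 2 * (norm (w - z))\<^sup>2) \<le> b - a - u \<bullet> (w - z)"
    using eventually_at_right_real[OF zero_less_one]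
    by (rule eventually_mono) (use * in auto)
  ultimately have "(1 - 0) * (\<rho> / 2 * (norm (w - z))\<^sup>2) \<le> b - a - u \<bullet> (w - z)"
    by (intro tendsto_upperbound) auto
  then show ?thesis
    by (simp add: a_def b_def)
qed

section \<open>Consequences of the standing assumptions\<close>

lemma has_gradient_edom: "has_gradient g G z \<Longrightarrow> z \<in> edom g"
  by (auto simp: has_gradient_def edom_def dest!: eventually_nhds_x_imp_x)

lemma dc_assumptionsE:
  fixes g h :: "'a::euclidean_space \<Rightarrow> ereal"
  assumes "dc_assumptions \<rho> g h"
  obtains G where "edom g = edom h" "open (edom h)"
    "\<And>z. z \<in> edom h \<Longrightarrow> has_gradient g (G z) z" "continuous_on (edom h) G"
proof -
  obtain U G where U: "open U" "edom h \<subseteq> U" "\<And>z. z \<in> U \<Longrightarrow> has_gradient g (G z) z"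
      "continuous_on U G"
    using assms unfolding dc_assumptions_def continuously_differentiable_on_def by metis
  have "U \<subseteq> edom g"
    using U(3) has_gradient_edom by blast
  moreover have "edom g \<subseteq> edom h"
  proof
    \<comment> \<open>Where \<open>g\<close> is finite and \<open>h\<close> infinite, the objective
      would be minus infinity.\<close>
    fix z assume z: "z \<in> edom g"
    have "-\<infinity> < (INF x. dc_objective g h x)"
      using assms by (simp add: dc_assumptions_def)
    also have "\<dots> \<le> g z - h z"
      by (rule INF_lower2[of z]) (simp_all add: dc_objective_def)
    finally show "z \<in> edom h"
      using z by (cases "h z"; cases "g z") (auto simp: edom_def)
  qed
  \<comment> \<open>The chain
    \<open>edom h \<subseteq> U \<subseteq> edom g \<subseteq> edom h\<close> closes up, so
    \<open>edom h\<close> inherits openness from \<open>U\<close>.\<close>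
  ultimately have "edom g = edom h" "edom h = U"
    using U(2) by auto
  then show ?thesis
    using that U by blast
qed

lemma dc_objective_real:
  assumes "dc_assumptions \<rho> g h" "z \<in> edom h"
  shows "dc_objective g h z = ereal (real_of_ereal (g z) - real_of_ereal (h z))"
proof -
  have "z \<in> edom g"
    using assms by (metis dc_assumptionsE)
  moreover have "proper_fun g" "proper_fun h"
    using assms(1) by (auto simp: dc_assumptions_def)
  ultimately have "g z = ereal (real_of_ereal (g z))" "h z = ereal (real_of_ereal (h z))"
    using proper_fun_real assms(2) by metis+
  then show ?thesis
    unfolding dc_objective_def by (metis ereal_minus(1))
qed

section \<open>Optimality in the subproblem and descent of the objective\<close>

lemma arg_min_linear_perturbation_subdifferential:
  assumes g: "proper_fun g"
    and y: "is_arg_min (\<lambda>z. g z - ereal (u \<bullet> z)) (\<lambda>_. True) y"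
  shows "u \<in> subdifferential g y"
proof -
  have min: "g y - ereal (u \<bullet> y) \<le> g z - ereal (u \<bullet> z)" for z
    using y by (auto simp: is_arg_min_def not_less)
  \<comment> \<open>Properness supplies a point with finite objective, which forces the minimal
    value and hence \<open>g y\<close> to be finite. Minimality then rearranges to the subgradient
    inequality.\<close>
  obtain z0 where "z0 \<in> edom g"
    using g by (auto simp: proper_fun_def)
  then have "g z0 - ereal (u \<bullet> z0) < \<infinity>"
    using g by (cases "g z0") (auto simp: edom_def)
  with min[of z0] have y: "y \<in> edom g"
    by (cases "g y") (auto simp: edom_def)
  show ?thesis
  proof (rule subdifferentialI_real[OF g y])
    fix w assume w: "w \<in> edom g"
    have "ereal (real_of_ereal (g y)) - ereal (u \<bullet> y) \<le> ereal (real_of_ereal (g w)) - ereal (u \<bullet> w)"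
      using min[of w] unfolding proper_fun_real[OF g w, symmetric] proper_fun_real[OF g y, symmetric] .
    then show "u \<bullet> (w - y) \<le> real_of_ereal (g w) - real_of_ereal (g y)"
      by (simp add: inner_diff_right)
  qed
qed

text \<open>Subtracting the linear function given by \<open>u\<close> makes \<open>z\<close> a local
  minimizer of \<open>g\<close>, so the derivative of the difference vanishes there; evaluating it
  at \<open>G - u\<close> gives a zero squared norm.\<close>

lemma subdifferential_eq_gradient:
  assumes g: "proper_fun g" and u: "u \<in> subdifferential g z" and G: "has_gradient g G z"
  shows "G = u"
proof -
  define f where "f w = real_of_ereal (g w) - u \<bullet> w" for w
  have "((\<lambda>w. real_of_ereal (g w)) has_derivative (\<lambda>v. v \<bullet> G)) (at z)"
    using G by (simp add: has_gradient_def gderiv_def)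
  then have der: "(f has_derivative (\<lambda>v. v \<bullet> G - u \<bullet> v)) (at z)"
    unfolding f_def by (auto intro!: derivative_eq_intros)
  have "\<forall>\<^sub>F w in nhds z. \<bar>g w\<bar> \<noteq> \<infinity>"
    using G by (simp add: has_gradient_def)
  then have ev: "\<forall>\<^sub>F w in nhds z. f z \<le> f w"
  proof eventually_elim
    case (elim w)
    then have "w \<in> edom g"
      by (auto simp: edom_def)
    from subdifferential_real_ineq[OF g u this] show ?case
      by (simp add: f_def inner_diff_right)
  qed
  then obtain S where S: "open S" "z \<in> S" "\<And>w. w \<in> S \<Longrightarrow> f z \<le> f w"
    unfolding eventually_nhds by blast
  have "(\<lambda>v. v \<bullet> G - u \<bullet> v) = (\<lambda>v. 0)"
    using differential_zero_maxmin[OF S(2,1) der] S(3) by blast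
  then have "(G - u) \<bullet> (G - u) = 0"
    by (metis inner_commute inner_diff_right)
  then show ?thesis
    by simp
qed

text \<open>The linear terms \<open>u \<bullet> (y - x)\<close> and
  \<open>u \<bullet> (x - y)\<close> cancel, while \<open>g\<close> and \<open>h\<close> contribute
  half of the quadratic term each.\<close>

lemma dc_step_decrease:
  assumes dc: "dc_assumptions \<rho> g h"
    and u: "u \<in> subdifferential h x" "u \<in> subdifferential g y"
  shows "dc_objective g h y \<le> dc_objective g h x - ereal (\<rho> * (norm (y - x))\<^sup>2)"
proof -
  have conv: "proper_fun g" "strongly_convex_fun \<rho> g" "proper_fun h" "strongly_convex_fun \<rho> h"
    using dc by (auto simp: dc_assumptions_def)
  have x: "x \<in> edom h" and y: "y \<in> edom g" and eq: "edom g = edom h"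
    using u subdifferential_edom dc by (auto elim: dc_assumptionsE)
  have "u \<bullet> (y - x) + \<rho> / 2 * (norm (y - x))\<^sup>2 \<le> real_of_ereal (h y) - real_of_ereal (h x)"
    using strongly_convex_subgradient_ineq[OF conv(3,4) u(1)] y eq by simp
  moreover have "u \<bullet> (x - y) + \<rho> / 2 * (norm (x - y))\<^sup>2 \<le> real_of_ereal (g x) - real_of_ereal (g y)"
    using strongly_convex_subgradient_ineq[OF conv(1,2) u(2)] x eq by simp
  ultimately show ?thesis
    using dc_objective_real[OF dc] x y eq
    by (simp add: norm_minus_commute[of x y] inner_diff_right)
qed

text \<open>Replacing \<open>h\<close> by its affine minorant at \<open>y\<close> with slope
  \<open>v\<close> bounds the change of the objective from above by a function differentiable at
  \<open>s = 0\<close>. Its slope \<open>(u - v) \<bullet> d\<close> is negative, and the term with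
  \<alpha> is of second order.\<close>

lemma dc_descent_direction:
  fixes g h :: "'a::euclidean_space \<Rightarrow> ereal"
  assumes dc: "dc_assumptions \<rho> g h"
    and u: "u \<in> subdifferential h x" "u \<in> subdifferential g y"
    and d: "d = y - x" "d \<noteq> 0"
  shows "\<forall>\<^sub>F s in at_right 0.
    dc_objective g h (y + s *\<^sub>R d) \<le> dc_objective g h y - ereal (\<alpha> * s\<^sup>2 * (norm d)\<^sup>2)"
proof -
  define gr hr where "gr z = real_of_ereal (g z)" and "hr z = real_of_ereal (h z)" for z
  have proper: "proper_fun g" "proper_fun h" "strongly_convex_fun \<rho> h" and \<rho>: "\<rho> > 0"
    using dc by (auto simp: dc_assumptions_def)
  obtain G where eq: "edom g = edom h" and op: "open (edom h)"
      and G: "\<And>z. z \<in> edom h \<Longrightarrow> has_gradient g (G z) z"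
    using dc by (metis dc_assumptionsE)
  have x: "x \<in> edom h" and y: "y \<in> edom h"
    using u subdifferential_edom eq by auto
  obtain v where v: "v \<in> subdifferential h y"
    using dc y by (auto simp: dc_assumptions_def)
  \<comment> \<open>This is strong monotonicity of the subdifferential of \<open>h\<close>, from the
    inequalities at \<open>x\<close> and at \<open>y\<close> added together.\<close>
  have mono: "\<rho> * (norm d)\<^sup>2 \<le> (v - u) \<bullet> d"
    using strongly_convex_subgradient_ineq[OF proper(2,3) u(1) y]
      strongly_convex_subgradient_ineq[OF proper(2,3) v x]
    by (simp add: d norm_minus_commute[of x y] inner_diff_right inner_diff_left)
  have "G y = u"
    using subdifferential_eq_gradient[OF proper(1) u(2) G[OF y]] .
  \<comment> \<open>The base point is written \<open>y + 0 *\<^sub>R d\<close> to fit the chain rule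
    at \<open>s = 0\<close>.\<close>
  then have "(gr has_derivative (\<lambda>w. w \<bullet> u)) (at (y + 0 *\<^sub>R d))"
    using G[OF y] unfolding gr_def by (simp add: has_gradient_def gderiv_def)
  then have "((\<lambda>s. gr (y + s *\<^sub>R d)) has_derivative (\<lambda>s. (s *\<^sub>R d) \<bullet> u)) (at 0)"
    by (rule has_derivative_compose[rotated]) (auto intro!: derivative_eq_intros)
  then have "((\<lambda>s. gr (y + s *\<^sub>R d)) has_field_derivative u \<bullet> d) (at 0)"
    by (simp add: has_field_derivative_def inner_commute[of d] mult_commute_abs)
  then have "((\<lambda>s. (gr (y + s *\<^sub>R d) - gr y) / s) \<longlongrightarrow> u \<bullet> d) (at 0)"
    by (simp add: has_field_derivative_iff)
  then have lim: "((\<lambda>s. (gr (y + s *\<^sub>R d) - gr y) / s) \<longlongrightarrow> u \<bullet> d) (at_right 0)"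
    by (rule filterlim_mono) (auto simp: at_le)
  have "((\<lambda>s. (gr (y + s *\<^sub>R d) - gr y) / s + \<alpha> * s * (norm d)\<^sup>2 - v \<bullet> d)
      \<longlongrightarrow> u \<bullet> d + \<alpha> * 0 * (norm d)\<^sup>2 - v \<bullet> d) (at_right 0)"
    by (intro tendsto_intros lim)
  moreover have "u \<bullet> d + \<alpha> * 0 * (norm d)\<^sup>2 - v \<bullet> d < 0"
  proof -
    have "0 < \<rho> * (norm d)\<^sup>2"
      using \<rho> d(2) by simp
    with mono show ?thesis
      by (simp add: inner_diff_left)
  qed
  ultimately have neg: "\<forall>\<^sub>F s in at_right 0.
      (gr (y + s *\<^sub>R d) - gr y) / s + \<alpha> * s * (norm d)\<^sup>2 - v \<bullet> d < 0"
    by (rule order_tendstoD(2))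
  have "((\<lambda>s. y + s *\<^sub>R d) \<longlongrightarrow> y + 0 *\<^sub>R d) (at_right 0)"
    by (intro tendsto_intros)
  \<comment> \<open>Openness of the domain keeps short steps inside it, where both functions are
    real-valued.\<close>
  then have "\<forall>\<^sub>F s in at_right 0. y + s *\<^sub>R d \<in> edom h"
    using op y by (intro topological_tendstoD) auto
  then show ?thesis
    using neg eventually_at_right_less[of 0]
  proof eventually_elim
    case (elim s)
    have "v \<bullet> (s *\<^sub>R d) \<le> hr (y + s *\<^sub>R d) - hr y"
      using subdifferential_real_ineq[OF proper(2) v elim(1)] by (simp add: hr_def)
    moreover have "s * ((gr (y + s *\<^sub>R d) - gr y) / s + \<alpha> * s * (norm d)\<^sup>2 - v \<bullet> d) < 0"
      using elim by (simp add: mult_pos_neg)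
    then have "gr (y + s *\<^sub>R d) - gr y + \<alpha> * s\<^sup>2 * (norm d)\<^sup>2 - s * (v \<bullet> d) < 0"
      using elim by (simp add: field_simps power2_eq_square)
    ultimately show ?case
      using dc_objective_real[OF dc elim(1)] dc_objective_real[OF dc y]
      by (simp add: gr_def hr_def)
  qed
qed

section \<open>Backtracking line search\<close>

lemma funpow_mult_left: "((\<lambda>s. b * s) ^^ n) s = b ^ n * (s :: 'a::comm_monoid_mult)"
  by (induction n) (simp_all add: ac_simps)

text \<open>For a positive trial value the steps \<open>\<beta> ^ n * l\<close> approach zero from
  the right, so some step satisfies the eventual inequality. For \<open>l = 0\<close> the acceptance
  test holds at once, with equality.\<close>

lemma line_search_terminates:
  assumes ev: "\<forall>\<^sub>F s in at_right 0. \<phi> (y + s *\<^sub>R d) \<le> \<phi> y - ereal (\<alpha> * s\<^sup>2 * (norm d)\<^sup>2)"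
    and \<beta>: "0 < \<beta>" "\<beta> < 1" and l: "l \<ge> 0"
  shows "line_search \<phi> \<alpha> \<beta> y d l \<noteq> None"
proof -
  have "\<exists>n. \<phi> (y + (\<beta> ^ n * l) *\<^sub>R d) \<le> \<phi> y - ereal (\<alpha> * (\<beta> ^ n * l)\<^sup>2 * (norm d)\<^sup>2)"
  proof (cases "l = 0")
    case False
    have "(\<lambda>n. \<beta> ^ n * l) \<longlonglongrightarrow> 0 * l"
      using \<beta> by (intro tendsto_intros LIMSEQ_realpow_zero) auto
    moreover have "\<beta> ^ n * l > 0" for n
      using \<beta> l False by simp
    ultimately have "filterlim (\<lambda>n. \<beta> ^ n * l) (at_right 0) sequentially"
      by (intro tendsto_imp_filterlim_at_right always_eventually allI) simp_all
    with ev have "\<forall>\<^sub>F n in sequentially.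
        \<phi> (y + (\<beta> ^ n * l) *\<^sub>R d) \<le> \<phi> y - ereal (\<alpha> * (\<beta> ^ n * l)\<^sup>2 * (norm d)\<^sup>2)"
      by (rule eventually_compose_filterlim)
    then show ?thesis
      by (meson eventually_sequentially order_refl)
  qed simp
  then show ?thesis
    \<comment> \<open>By definition \<open>while_option\<close> returns \<open>None\<close> only if
      every iterate satisfies the loop guard.\<close>
    unfolding line_search_def while_option_def funpow_mult_left by (auto simp: not_less)
qed

lemma line_search_SomeD:
  assumes "line_search \<phi> \<alpha> \<beta> y d l = Some s" "0 < \<beta>" "0 \<le> l"
  shows "0 \<le> s" "\<phi> (y + s *\<^sub>R d) \<le> \<phi> y - ereal (\<alpha> * s\<^sup>2 * (norm d)\<^sup>2)"
proof -
  show "\<phi> (y + s *\<^sub>R d) \<le> \<phi> y - ereal (\<alpha> * s\<^sup>2 * (norm d)\<^sup>2)"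
    using while_option_stop[OF assms(1)[unfolded line_search_def]] by (simp add: not_less)
  obtain n where "s = \<beta> ^ n * l"
    using while_option_stop2[OF assms(1)[unfolded line_search_def]]
    unfolding funpow_mult_left by blast
  then show "0 \<le> s"
    using assms by simp
qed

section \<open>Limits of subgradients and bounded sublevel sets\<close>

lemma subdifferential_closed:
  fixes h :: "'a::euclidean_space \<Rightarrow> ereal"
  assumes h: "proper_fun h" and z: "subdifferential h z \<noteq> {}"
    and u: "\<And>k. u k \<in> subdifferential h (x k)"
    and lim: "x \<longlonglongrightarrow> z" "u \<longlonglongrightarrow> v"
  shows "v \<in> subdifferential h z"
proof -
  \<comment> \<open>The subgradient \<open>p\<close> stands in for lower semicontinuity: it gives
    \<open>h (x k) \<ge> h z + p \<bullet> (x k - z)\<close>, and the linear term tends to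
    zero.\<close>
  obtain p where p: "p \<in> subdifferential h z"
    using z by blast
  show ?thesis
  proof (rule subdifferentialI_real[OF h subdifferential_edom[OF p]])
    fix w assume w: "w \<in> edom h"
    have "u k \<bullet> (w - x k) + p \<bullet> (x k - z) \<le> real_of_ereal (h w) - real_of_ereal (h z)" for k
      using subdifferential_real_ineq[OF h u w]
        subdifferential_real_ineq[OF h p subdifferential_edom[OF u]] by (smt (verit))
    moreover have "(\<lambda>k. u k \<bullet> (w - x k) + p \<bullet> (x k - z)) \<longlonglongrightarrow> v \<bullet> (w - z) + p \<bullet> (z - z)"
      by (intro tendsto_intros lim)
    ultimately have "v \<bullet> (w - z) + p \<bullet> (z - z) \<le> real_of_ereal (h w) - real_of_ereal (h z)"
      by (intro LIMSEQ_le_const2) auto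
    then show "v \<bullet> (w - z) \<le> real_of_ereal (h w) - real_of_ereal (h z)"
      by simp
  qed
qed

lemma coercive_sublevel_bounded:
  fixes f :: "'a::euclidean_space \<Rightarrow> ereal"
  assumes "coercive f" "c < \<infinity>"
  shows "bounded {x. f x \<le> c}"
proof -
  have "\<forall>\<^sub>F x in at_infinity. c < f x"
    using assms unfolding coercive_def by (intro order_tendstoD(1))
  then obtain b where b: "\<And>x. b \<le> norm x \<Longrightarrow> c < f x"
    by (auto simp: eventually_at_infinity)
  then have "norm x \<le> b" if "f x \<le> c" for x
    using that by (meson linear not_le)
  then show ?thesis
    by (auto simp: bounded_iff)
qed

section \<open>Convergence of BDCA\<close>

theorem theorem3p1:
  fixes g h :: "'a::euclidean_space \<Rightarrow> ereal"
    and \<rho> \<alpha> \<beta> :: real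
    and x0 :: 'a
    and N :: enat
    and x u y d :: "nat \<Rightarrow> 'a"
    and lbar lam :: "nat \<Rightarrow> real"
  assumes "dc_assumptions \<rho> g h"
    and "\<alpha> > 0" and "0 < \<beta>" and "\<beta> < 1"
    and "bdca_run g h \<alpha> \<beta> x0 N x u y d lbar lam"
  shows
    "(\<exists>n. N = enat n \<and> d n = 0 \<and> critical_point g h (x n)) \<or>
     (N = \<infinity> \<and>
      (decseq (\<lambda>k. dc_objective g h (x k)) \<and>
       (\<exists>\<phi>star::real. (\<lambda>k. dc_objective g h (x k)) \<longlonglongrightarrow> ereal \<phi>star)) \<and>
      ((\<forall>z\<in>edom h. limit_point_of_seq x z \<longrightarrow> critical_point g h z) \<and>
       (coercive (dc_objective g h) \<and> (\<forall>z. limit_point_of_seq x z \<longrightarrow> z \<in> edom h) \<longrightarrow>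
        (\<exists>r z. strict_mono r \<and> (x \<circ> r) \<longlonglongrightarrow> z \<and> critical_point g h z))) \<and>
      (summable (\<lambda>k. (norm (d k))\<^sup>2) \<and>
       ((\<exists>lmax. \<forall>k. lam k \<le> lmax) \<longrightarrow>
        summable (\<lambda>k. (norm (x (Suc k) - x k))\<^sup>2))))"
proof -
  define \<phi> where "\<phi> = dc_objective g h"
  have proper: "proper_fun g" "proper_fun h" and \<rho>: "\<rho> > 0"
    and ne: "\<And>z. z \<in> edom h \<Longrightarrow> subdifferential h z \<noteq> {}"
    using assms(1) by (auto simp: dc_assumptions_def)
  obtain G where eq: "edom g = edom h"
      and G: "\<And>z. z \<in> edom h \<Longrightarrow> has_gradient g (G z) z" and contG: "continuous_on (edom h) G"
      and op: "open (edom h)"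
    using assms(1) by (metis dc_assumptionsE)
  \<comment> \<open>The bound \<open>enat k \<le> N\<close> includes the entered but uncompleted
    last iteration of a finite run.\<close>
  have uh: "u k \<in> subdifferential h (x k)" and ug: "u k \<in> subdifferential g (y k)"
    and d: "d k = y k - x k" if "enat k \<le> N" for k
    using assms(5) that arg_min_linear_perturbation_subdifferential[OF proper(1)]
    by (auto simp: bdca_run_def)
  have Gy: "G (y k) = u k" if "enat k \<le> N" for k
    using subdifferential_eq_gradient[OF proper(1) ug[OF that]] G
      subdifferential_edom[OF ug[OF that]] eq by blast
  show ?thesis
  proof (cases N)
    case (enat n)
    \<comment> \<open>Otherwise the run could only have ended in a nonterminating line search, which
      the descent direction excludes.\<close>
    have "d n = 0"
    proof (rule ccontr)
      assume "d n \<noteq> 0"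
      then have "lbar n \<ge> 0" and None: "line_search \<phi> \<alpha> \<beta> (y n) (d n) (lbar n) = None"
        using assms(5) enat by (auto simp: bdca_run_def \<phi>_def)
      moreover have "enat n \<le> N"
        using enat by simp
      ultimately show False
        using line_search_terminates[OF dc_descent_direction[OF assms(1) uh ug d] assms(3,4)]
          \<open>d n \<noteq> 0\<close> by (auto simp: \<phi>_def)
    qed
    moreover have "critical_point g h (x n)"
    proof -
      \<comment> \<open>Hence the gradient of \<open>g\<close> at \<open>x n\<close> is
        \<open>u n\<close>, which is a subgradient of \<open>h\<close> at the same point.\<close>
      have "y n = x n"
        using d[of n] enat \<open>d n = 0\<close> by simp
      then show ?thesis
        using uh[of n] Gy[of n] G[of "x n"] subdifferential_edom[OF uh[of n]] enat
        by (auto simp: critical_point_def)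
    qed
    ultimately show ?thesis
      using enat by blast
  next
    case infinity
    have xdom: "x k \<in> edom h" and ydom: "y k \<in> edom h" for k
      using subdifferential_edom[OF uh[of k]] subdifferential_edom[OF ug[of k]] infinity eq
      by auto
    have lb: "lbar k \<ge> 0" and ls: "line_search \<phi> \<alpha> \<beta> (y k) (d k) (lbar k) = Some (lam k)"
      and xS: "x (Suc k) = y k + lam k *\<^sub>R d k" for k
      using assms(5) infinity by (auto simp: bdca_run_def \<phi>_def)
    note lam = line_search_SomeD[OF ls assms(3) lb]
    define a where "a k = real_of_ereal (g (x k)) - real_of_ereal (h (x k))" for k
    have \<phi>x: "\<phi> (x k) = ereal (a k)" for k
      unfolding \<phi>_def a_def by (rule dc_objective_real[OF assms(1) xdom])
    have step: "\<rho> * (norm (d k))\<^sup>2 \<le> a k - a (Suc k)" for k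
    proof -
      have "\<phi> (y k) \<le> \<phi> (x k) - ereal (\<rho> * (norm (d k))\<^sup>2)"
        using dc_step_decrease[OF assms(1) uh ug, of k] d[of k] infinity by (simp add: \<phi>_def)
      moreover have "\<phi> (x (Suc k)) \<le> \<phi> (y k) - ereal (\<alpha> * (lam k)\<^sup>2 * (norm (d k))\<^sup>2)"
        using lam(2)[of k] xS by simp
      moreover obtain b where "\<phi> (y k) = ereal b"
        using dc_objective_real[OF assms(1) ydom] by (auto simp: \<phi>_def)
      \<comment> \<open>The line search can only lower the objective further, so the decrease from
        \<open>x k\<close> to \<open>y k\<close> suffices.\<close>
      moreover have "0 \<le> \<alpha> * (lam k)\<^sup>2 * (norm (d k))\<^sup>2"
        using assms(2) by simp
      ultimately show ?thesis
        using \<phi>x[of k] \<phi>x[of "Suc k"] by simp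
    qed
    have dec: "decseq a"
    proof (rule decseq_SucI)
      fix k
      have "0 \<le> \<rho> * (norm (d k))\<^sup>2"
        using \<rho> by simp
      with step[of k] show "a (Suc k) \<le> a k"
        by linarith
    qed
    have "-\<infinity> < (INF z. \<phi> z)"
      using assms(1) by (simp add: dc_assumptions_def \<phi>_def)
    then obtain c where c: "ereal c < (INF z. \<phi> z)"
      using ereal_dense2 by blast
    have "c \<le> a k" for k
      using less_le_trans[OF c INF_lower[of "x k" UNIV \<phi>]] \<phi>x[of k] by simp
    then obtain L where L: "a \<longlonglongrightarrow> L"
      using decseq_convergent[OF dec] by blast
    \<comment> \<open>The decreases telescope, and divided by \<rho> they dominate the squared norms
      of \<open>d k\<close>.\<close>
    have "summable (\<lambda>k. (a k - a (Suc k)) / \<rho>)"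
      using telescope_summable'[OF L] by (rule summable_divide)
    then have sumd: "summable (\<lambda>k. (norm (d k))\<^sup>2)"
    proof (rule summable_comparison_test_ev[rotated])
      show "\<forall>\<^sub>F k in sequentially. norm ((norm (d k))\<^sup>2) \<le> (a k - a (Suc k)) / \<rho>"
        using step \<rho> by (auto simp: field_simps)
    qed
    have d0: "d \<longlonglongrightarrow> 0"
    proof -
      have "(\<lambda>k. sqrt ((norm (d k))\<^sup>2)) \<longlonglongrightarrow> sqrt 0"
        by (intro tendsto_real_sqrt summable_LIMSEQ_zero sumd)
      then show ?thesis
        by (simp add: tendsto_norm_zero_iff)
    qed
    have crit: "critical_point g h z"
      if z: "z \<in> edom h" and r: "strict_mono r" "(x \<circ> r) \<longlonglongrightarrow> z" for z r
    proof -
      \<comment> \<open>Since \<open>d\<close> tends to zero, \<open>y (r k)\<close> has the same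
        limit as \<open>x (r k)\<close>. Continuity of the gradient at \<open>z\<close> then carries
        over to \<open>u (r k) = G (y (r k))\<close>.\<close>
      have "(\<lambda>k. x (r k) + d (r k)) \<longlonglongrightarrow> z + 0"
        using r(2) LIMSEQ_subseq_LIMSEQ[OF d0 r(1)] by (intro tendsto_add) (auto simp: o_def)
      then have "(\<lambda>k. y (r k)) \<longlonglongrightarrow> z"
        using d infinity by simp
      then have "(\<lambda>k. G (y (r k))) \<longlonglongrightarrow> G z"
        using contG op z by (intro isCont_tendsto_compose[of z G]) (auto simp: continuous_on_eq_continuous_at)
      then have "(\<lambda>k. u (r k)) \<longlonglongrightarrow> G z"
        using Gy infinity by simp
      then have "G z \<in> subdifferential h z"
        using subdifferential_closed[OF proper(2) ne[OF z], of "\<lambda>k. u (r k)" "\<lambda>k. x (r k)"]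
          uh infinity r(2) by (simp add: o_def)
      then show ?thesis
        using G[OF z] by (auto simp: critical_point_def)
    qed
    have "decseq (\<lambda>k. \<phi> (x k))" and "(\<lambda>k. \<phi> (x k)) \<longlonglongrightarrow> ereal L"
      using dec L by (auto simp: \<phi>x decseq_def)
    moreover have "\<exists>r z. strict_mono r \<and> (x \<circ> r) \<longlonglongrightarrow> z \<and> critical_point g h z"
      if co: "coercive \<phi>" and dom: "\<forall>z. limit_point_of_seq x z \<longrightarrow> z \<in> edom h"
    proof -
      \<comment> \<open>Monotonicity keeps the iterates in the initial sublevel set, bounded by
        coercivity. That the limit lies in \<open>edom h\<close> comes from
        \<open>dom\<close>.\<close>
      have "range x \<subseteq> {z. \<phi> z \<le> \<phi> (x 0)}"
        using dec by (auto simp: \<phi>x decseq_def)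
      then have "bounded (range x)"
        using coercive_sublevel_bounded[OF co, of "\<phi> (x 0)"] by (auto simp: \<phi>x intro: bounded_subset)
      then obtain z r where "strict_mono r" "(x \<circ> r) \<longlonglongrightarrow> z"
        using bounded_imp_convergent_subsequence by blast
      then show ?thesis
        using crit dom by (meson limit_point_of_seq_def)
    qed
    moreover have "summable (\<lambda>k. (norm (x (Suc k) - x k))\<^sup>2)" if lmax: "\<And>k. lam k \<le> lmax" for lmax
    proof (rule summable_comparison_test_ev)
      show "summable (\<lambda>k. (1 + lmax)\<^sup>2 * (norm (d k))\<^sup>2)"
        using sumd by (rule summable_mult)
      have "(norm (x (Suc k) - x k))\<^sup>2 \<le> (1 + lmax)\<^sup>2 * (norm (d k))\<^sup>2" for k
      proof -
        have "x (Suc k) - x k = (1 + lam k) *\<^sub>R d k"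
          using d[of k] infinity by (simp add: xS scaleR_add_left)
        then have "(norm (x (Suc k) - x k))\<^sup>2 = (1 + lam k)\<^sup>2 * (norm (d k))\<^sup>2"
          by (simp add: power_mult_distrib)
        also have "\<dots> \<le> (1 + lmax)\<^sup>2 * (norm (d k))\<^sup>2"
          \<comment> \<open>Nonnegativity of \<open>lam k\<close> makes squaring monotone on
            \<open>1 + lam k \<le> 1 + lmax\<close>.\<close>
          using lam(1)[of k] lmax[of k] by (intro mult_right_mono power_mono) auto
        finally show ?thesis .
      qed
      then show "\<forall>\<^sub>F k in sequentially.
          norm ((norm (x (Suc k) - x k))\<^sup>2) \<le> (1 + lmax)\<^sup>2 * (norm (d k))\<^sup>2"
        by simp
    qed
    moreover have "\<forall>z\<in>edom h. limit_point_of_seq x z \<longrightarrow> critical_point g h z"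
      using crit by (auto simp: limit_point_of_seq_def)
    ultimately show ?thesis
      using infinity sumd unfolding \<phi>_def by (intro disjI2 conjI impI) blast+
  qed
qed

end
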